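(* Let $0<\kappa<1$ be given. Assume that the initial configuration $f\in\mathcal{F}$ is well stirred up to scale $\varepsilon$ (where $\varepsilon>0$). Then the cost of any rearrangement $f_0,f_1,\ldots,f_n$ of $f$ satisfies $$\Gamma(f_0,\ldots,f_n)\ \ge\ C_\kappa\,|\log\varepsilon|$$ for some constant $C_\kappa>0$ independent of $f,\varepsilon$.
   Context: $\mathcal{F}$ is the set of all piecewise constant functions $f:[0,1]\to\{0,1\}$. Well stirred: for the given $\kappa\in\,]0,1[$, the configuration $f\in\mathcal{F}$ is well stirred up to scale $\varepsilon$ provided that $$\kappa\varepsilon<\int_y^{y+\varepsilon} f(x)\,dx\le(1-\kappa)\varepsilon\qquad\text{for all } y\in[0,1-\varepsilon].$$ Elementary transposition: for $f,g\in\mathcal{F}$, $g$ is obtained from $f$ by an elementary transposition if, for some $y\in[0,1[$ and $a,b>0$, one has $$f(x)=\begin{cases}1 & \text{if } y<x<y+a,\\ 0 & \text{if } y+a<x<y+a+b,\end{cases}\qquad g(x)=\begin{cases}0 & \text{if } y<x<y+b,\\ 1 & \text{if } y+b<x<y+b+a,\\ f(x) & \text{if } x\notin[y,y+a+b].\end{cases}$$ The cost of this transposition is $a+b$. Rearrangement: a rearrangement of $f\in\mathcal{F}$ is a finite sequence $f_0,f_1,\ldots,f_n\in\mathcal{F}$ such that (i) $f_0=f$; (ii) $f_n$ is nondecreasing; (iii) each $f_j$ is obtained from $f_{j-1}$ by an elementary transposition. The cost $\Gamma(f_0,f_1,\ldots,f_n)$ of the rearrangement is the sum of the costs of the transpo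sitions.
   Formalization: The scale is restricted to 0 < ε ≤ 1/2, since for larger ε the claim fails: e.g. with κ = 1/4, ε = 9/10 the indicator of ]1/2,1] is well stirred and already nondecreasing, so its rearrangement costs 0. *)

theory Defs
  imports "HOL-Analysis.Analysis"
begin

(* Configurations are extensional functions on [0,1], so that HOL equality of
   configurations is equality of functions on [0,1].  Values at the finitely many
   breakpoints are arbitrary. *)

definition piecewise_constant :: "(real \<Rightarrow> real) \<Rightarrow> bool" where
  "piecewise_constant f \<longleftrightarrow>
     (\<exists>(m::nat) t. t 0 = 0 \<and> t m = 1 \<and>
        (\<forall>i<m. t i < t (Suc i) \<and> f constant_on {t i<..<t (Suc i)}))"

definition configurations :: "(real \<Rightarrow> real) set" where
  "configurations = {f \<in> {0..1} \<rightarrow>\<^sub>E {0, 1}. piecewise_constant f}"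

definition well_stirred :: "real \<Rightarrow> real \<Rightarrow> (real \<Rightarrow> real) \<Rightarrow> bool" where
  "well_stirred \<kappa> \<epsilon> f \<longleftrightarrow>
     (\<forall>y\<in>{0..1 - \<epsilon>}.
        \<kappa> * \<epsilon> < integral {y..y + \<epsilon>} f \<and> integral {y..y + \<epsilon>} f \<le> (1 - \<kappa>) * \<epsilon>)"

(* The condition y + a + b <= 1 is implicit on paper: f is only defined on [0,1]. *)

definition transposition_at ::
    "real \<Rightarrow> real \<Rightarrow> real \<Rightarrow> (real \<Rightarrow> real) \<Rightarrow> (real \<Rightarrow> real) \<Rightarrow> bool" where
  "transposition_at y a b f g \<longleftrightarrow>
     0 \<le> y \<and> y < 1 \<and> 0 < a \<and> 0 < b \<and> y + a + b \<le> 1 \<and>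
     (\<forall>x. y < x \<and> x < y + a \<longrightarrow> f x = 1) \<and>
     (\<forall>x. y + a < x \<and> x < y + a + b \<longrightarrow> f x = 0) \<and>
     (\<forall>x. y < x \<and> x < y + b \<longrightarrow> g x = 0) \<and>
     (\<forall>x. y + b < x \<and> x < y + b + a \<longrightarrow> g x = 1) \<and>
     (\<forall>x\<in>{0..1}. x \<notin> {y..y + a + b} \<longrightarrow> g x = f x)"

definition elementary_transposition :: "(real \<Rightarrow> real) \<Rightarrow> (real \<Rightarrow> real) \<Rightarrow> bool" where
  "elementary_transposition f g \<longleftrightarrow> (\<exists>y a b. transposition_at y a b f g)"

(* Well defined by transposition_cost_eq below. *)

definition transposition_cost :: "(real \<Rightarrow> real) \<Rightarrow> (real \<Rightarrow> real) \<Rightarrow> real" where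
  "transposition_cost f g = (THE c. \<exists>y a b. transposition_at y a b f g \<and> c = a + b)"

lemma transposition_at_unique:
  assumes "transposition_at y a b f g" "transposition_at y' a' b' f g"
  shows "y = y' \<and> a + b = a' + b'"
proof -
  have start: "y' \<le> y"
    if A: "transposition_at y a b f g" and B: "transposition_at y' a' b' f g"
    for y a b y' a' b'
  proof (rule ccontr)
    assume "\<not> y' \<le> y"
    then have "y < min y' (y + min a b)"
      using A by (auto simp: transposition_at_def)
    then obtain x where "y < x" and "x < min y' (y + min a b)"
      using dense by blast
    then have x: "y < x" "x < y'" "x < y + a" "x < y + b"
      by (auto simp: min_def split: if_splits)
    have "f x = 1" "g x = 0"
      using A x by (auto simp: transposition_at_def)
    moreover have "g x = f x"
      using A B x by (auto simp: transposition_at_def)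
    ultimately show False by simp
  qed
  have finish: "y + a + b \<le> y' + a' + b'"
    if A: "transposition_at y a b f g" and B: "transposition_at y' a' b' f g"
    for y a b y' a' b'
  proof (rule ccontr)
    assume "\<not> y + a + b \<le> y' + a' + b'"
    then have "max (y' + a' + b') (y + max a b) < y + a + b"
      using A by (auto simp: transposition_at_def)
    then obtain x where "max (y' + a' + b') (y + max a b) < x" and x1: "x < y + a + b"
      using dense by blast
    then have x: "y' + a' + b' < x" "y + a < x" "y + b < x"
      by (auto simp: max_def split: if_splits)
    have "f x = 0" "g x = 1"
      using A x x1 by (auto simp: transposition_at_def)
    moreover have "x \<in> {0..1}" "x \<notin> {y'..y' + a' + b'}"
      using A x x1 by (auto simp: transposition_at_def)
    then have "g x = f x"
      using B by (auto simp: transposition_at_def)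
    ultimately show False by simp
  qed
  show ?thesis
    using start[OF assms] start[OF assms(2,1)] finish[OF assms] finish[OF assms(2,1)] by auto
qed

lemma transposition_cost_eq:
  assumes "transposition_at y a b f g"
  shows "transposition_cost f g = a + b"
  unfolding transposition_cost_def
proof (rule the_equality)
  show "\<exists>y' a' b'. transposition_at y' a' b' f g \<and> a + b = a' + b'"
    using assms by blast
  show "c = a + b" if "\<exists>y' a' b'. transposition_at y' a' b' f g \<and> c = a' + b'" for c
    using that transposition_at_unique[OF assms] by auto
qed

definition rearrangement :: "(real \<Rightarrow> real) \<Rightarrow> nat \<Rightarrow> (nat \<Rightarrow> real \<Rightarrow> real) \<Rightarrow> bool" where
  "rearrangement f n F \<longleftrightarrow>
     (\<forall>j\<le>n. F j \<in> configurations) \<and>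
     F 0 = f \<and>
     mono_on {0..1} (F n) \<and>
     (\<forall>j\<in>{1..n}. elementary_transposition (F (j - 1)) (F j))"

definition rearrangement_cost :: "nat \<Rightarrow> (nat \<Rightarrow> real \<Rightarrow> real) \<Rightarrow> real" where
  "rearrangement_cost n F = (\<Sum>j = 1..n. transposition_cost (F (j - 1)) (F j))"

(* The lower bound C * |ln \<epsilon>| is stated for scales \<epsilon> \<le> 1/2, since it fails at large
   scales:  for \<epsilon> > 1 every configuration is vacuously well stirred, and for
   1 / (2 * (1 - \<kappa>)) < \<epsilon> < 1 the indicator of ]1/2,1] is well stirred; nondecreasing
   configurations admit n = 0, with cost 0.  As \<kappa> \<rightarrow> 0 the threshold 1 / (2 * (1 - \<kappa>)) tends to 1/2. *)

end

theory Submission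
  imports Defs
begin

text \<open>
  Say that a point of value \<open>1\<close> and a point of value \<open>0\<close> form an inversion when the former lies
  to the left of the latter.  The proof weighs an inversion \<open>x < y\<close> by \<open>1 / (y - x)\<close> and uses the
  total weight \<open>E f\<close> of all inversions of \<open>f\<close> as a potential (\<open>interaction\<close> below).

  A nondecreasing configuration has no inversions, so its potential vanishes.

  An elementary transposition of cost \<open>a + b\<close> lowers the potential by at most \<open>a + b\<close>
  (\<open>interaction_transposition\<close>).  Indeed, the moved ones get closer to all the zeros on the right of
  the transposed block, and the moved zeros get closer to all the ones on its left; as the kernel
  decreases with the distance, these contributions can only grow.  The only loss comes from the
  inversions inside the block, and their weight is
  \[ \int_0^a \int_0^b \frac{dt\,ds}{s + t} \le \int_0^a \int_0^b \frac{dt\,ds}{2 \sqrt{s t}}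
     = 2 \sqrt{a b} \le a + b . \]
  Summing over a rearrangement, its cost is at least \<open>E f\<close> (\<open>interaction_le_cost\<close>).

  A configuration that is well stirred up to scale \<open>\<epsilon>\<close> has potential at least
  \<open>\<kappa>\<^sup>2 / 8 * ln (1 / \<epsilon>)\<close> (\<open>well_stirred_interaction\<close>).  To the right of a point \<open>x \<le> 1/2\<close> of
  value \<open>1\<close> there is room for about \<open>1 / (2 * \<epsilon>)\<close> consecutive windows of length \<open>\<epsilon>\<close>.  Each
  contains zeros of measure at least \<open>\<kappa> * \<epsilon>\<close>, and those in the \<open>d\<close>-th one are at distance at most
  \<open>d * \<epsilon>\<close>; so \<open>x\<close> contributes at least \<open>\<kappa>\<close> times a harmonic number.  Such points \<open>x\<close> in turn fill
  a set of measure at least \<open>\<kappa> / 4\<close>.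
\<close>

section \<open>Level sets of configurations\<close>

definition ones :: "(real \<Rightarrow> real) \<Rightarrow> real set" where
  "ones f = {x \<in> {0..1}. f x = 1}"

definition zeros :: "(real \<Rightarrow> real) \<Rightarrow> real set" where
  "zeros f = {x \<in> {0..1}. f x = 0}"

lemma partition_covers:
  fixes t :: "nat \<Rightarrow> real"
  assumes "\<And>i. i < m \<Longrightarrow> t i < t (Suc i)" and "t 0 \<le> x" and "x \<le> t m"
  shows "x \<in> t ` {..m} \<union> (\<Union>i<m. {t i<..<t (Suc i)})"
  using assms
proof (induction m)
  case 0
  then show ?case by auto
next
  case (Suc m)
  show ?case
  proof (cases "x \<le> t m")
    case True
    then have "x \<in> t ` {..m} \<union> (\<Union>i<m. {t i<..<t (Suc i)})"
      using Suc by simp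
    then show ?thesis by (auto simp: less_Suc_eq)
  next
    case False
    then have "x = t (Suc m) \<or> x \<in> {t m<..<t (Suc m)}"
      using Suc.prems(3) by auto
    then show ?thesis by (auto simp: lessThan_Suc atMost_Suc)
  qed
qed

lemma level_set_borel:
  assumes "f \<in> configurations"
  shows "{x \<in> {0..1}. f x = c} \<in> sets borel"
proof -
  obtain m t where t: "t (0::nat) = 0" "t m = (1::real)" "\<And>i. i < m \<Longrightarrow> t i < t (Suc i)"
    and const: "\<And>i. i < m \<Longrightarrow> f constant_on {t i<..<t (Suc i)}"
    using assms unfolding configurations_def piecewise_constant_def by blast
  let ?L = "{x \<in> {0..1}. f x = c}"
  have piece: "?L \<inter> {t i<..<t (Suc i)} \<in> sets borel" if i: "i < m" for i
  proof -
    obtain d where d: "\<forall>x\<in>{t i<..<t (Suc i)}. f x = d"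
      using const[OF i] unfolding constant_on_def by blast
    show ?thesis
    proof (cases "d = c")
      case True
      then have "?L \<inter> {t i<..<t (Suc i)} = {0..1} \<inter> {t i<..<t (Suc i)}"
        using d by blast
      then show ?thesis by simp
    next
      case False
      have "f x \<noteq> c" if "x \<in> {t i<..<t (Suc i)}" for x
        using d that False by simp
      then have "?L \<inter> {t i<..<t (Suc i)} = {}"
        by blast
      then show ?thesis by (simp only: sets.empty_sets)
    qed
  qed
  have decomp: "?L = (?L \<inter> t ` {..m}) \<union> (\<Union>i<m. ?L \<inter> {t i<..<t (Suc i)})"
  proof (intro set_eqI iffI)
    fix x assume "x \<in> ?L"
    moreover from this have "x \<in> t ` {..m} \<union> (\<Union>i<m. {t i<..<t (Suc i)})"
      using t by (intro partition_covers) auto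
    ultimately show "x \<in> (?L \<inter> t ` {..m}) \<union> (\<Union>i<m. ?L \<inter> {t i<..<t (Suc i)})"
      by blast
  qed blast
  have "?L \<inter> t ` {..m} \<in> sets borel"
    by (rule borel_closed, rule finite_imp_closed) simp
  moreover have "(\<Union>i<m. ?L \<inter> {t i<..<t (Suc i)}) \<in> sets borel"
    by (rule sets.finite_UN) (use piece in simp_all)
  ultimately show ?thesis
    by (subst decomp) (rule sets.Un)
qed

lemma ones_borel [measurable]: "f \<in> configurations \<Longrightarrow> ones f \<in> sets borel"
  and zeros_borel [measurable]: "f \<in> configurations \<Longrightarrow> zeros f \<in> sets borel"
  unfolding ones_def zeros_def by (rule level_set_borel, assumption)+

section \<open>The potential\<close>

text \<open>
  There is no factor restricting the integral to \<open>x < y\<close>: for \<open>y \<le> x\<close> the quotient is nonpositive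
  (it is \<open>0\<close> at \<open>x = y\<close>), and \<open>ennreal\<close> sends it to \<open>0\<close>.  Working in the extended nonnegative
  reals makes integrability of the singular kernel a non-issue.
\<close>

definition interaction :: "real set \<Rightarrow> real set \<Rightarrow> ennreal" where
  "interaction X Y =
     (\<integral>\<^sup>+ x. \<integral>\<^sup>+ y. indicator X x * indicator Y y * ennreal (1 / (y - x)) \<partial>lborel \<partial>lborel)"

lemma interaction_monotone:
  assumes "mono_on {0..1} f"
  shows "interaction (ones f) (zeros f) = 0"
proof -
  have zero: "indicator (ones f) x * indicator (zeros f) y * ennreal (1 / (y - x)) = 0" for x y
    using mono_onD[OF assms, of x y]
    by (cases "x < y") (auto simp: ones_def zeros_def indicator_def ennreal_neg)
  show ?thesis unfolding interaction_def by (simp only: zero nn_integral_const mult_zero_left)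
qed

text \<open>
  The values of a configuration at the ends of the transposed intervals are arbitrary, so level sets
  are known only up to finitely many points.
\<close>

lemma interaction_cong_null:
  assumes "finite N" and "\<And>x. x \<notin> N \<Longrightarrow> x \<in> X \<longleftrightarrow> x \<in> X'" and "\<And>x. x \<notin> N \<Longrightarrow> x \<in> Y \<longleftrightarrow> x \<in> Y'"
  shows "interaction X Y = interaction X' Y'"
proof -
  have ae: "AE x in lborel. x \<notin> N"
    using assms(1) by (intro AE_not_in finite_imp_null_set_lborel)
  have "(\<integral>\<^sup>+ y. indicator X x * indicator Y y * ennreal (1 / (y - x)) \<partial>lborel)
      = (\<integral>\<^sup>+ y. indicator X' x * indicator Y' y * ennreal (1 / (y - x)) \<partial>lborel)"
    if "x \<notin> N" for x
    using ae by (intro nn_integral_cong_AE) (elim eventually_mono, simp add: indicator_def that assms)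
  then show ?thesis
    unfolding interaction_def using ae by (intro nn_integral_cong_AE) (elim eventually_mono, simp)
qed

lemma interaction_Un_left:
  assumes [measurable]: "A \<in> sets borel" "B \<in> sets borel" "Y \<in> sets borel" and "A \<inter> B = {}"
  shows "interaction (A \<union> B) Y = interaction A Y + interaction B Y"
proof -
  have "indicator (A \<union> B) x = indicator A x + (indicator B x :: ennreal)" for x
    using assms(4) by (auto simp: indicator_def)
  then show ?thesis
    unfolding interaction_def by (simp add: distrib_right nn_integral_add)
qed

lemma interaction_Un_right:
  assumes [measurable]: "A \<in> sets borel" "B \<in> sets borel" "X \<in> sets borel" and "A \<inter> B = {}"
  shows "interaction X (A \<union> B) = interaction X A + interaction X B"
proof -
  have "indicator (A \<union> B) x = indicator A x + (indicator B x :: ennreal)" for x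
    using assms(4) by (auto simp: indicator_def)
  then show ?thesis
    unfolding interaction_def by (simp add: distrib_right distrib_left nn_integral_add)
qed

section \<open>Effect of a transposition on the potential\<close>

lemma nn_integral_lborel_shift:
  fixes f :: "real \<Rightarrow> ennreal"
  assumes "f \<in> borel_measurable borel"
  shows "(\<integral>\<^sup>+ x. f x \<partial>lborel) = (\<integral>\<^sup>+ x. f (x + c) \<partial>lborel)"
  using nn_integral_real_affine[OF assms, of 1 c] by (simp add: add.commute)

lemma nn_integral_lborel_reflect:
  fixes f :: "real \<Rightarrow> ennreal"
  assumes "f \<in> borel_measurable borel"
  shows "(\<integral>\<^sup>+ x. f x \<partial>lborel) = (\<integral>\<^sup>+ x. f (c - x) \<partial>lborel)"
  using nn_integral_real_affine[OF assms, of "-1" c] by simp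

text \<open>
  Moving an interval of ones to the right within the block brings it closer to each zero on the right
  of the block, while zeros on the left of the block never interact with it.
\<close>

lemma interaction_shift_right:
  assumes [measurable]: "V \<in> sets borel" and "V \<inter> {y..y + a + b} = {}" and "0 \<le> b"
  shows "interaction {y<..<y + a} V \<le> interaction {y + b<..<y + b + a} V"
proof -
  have "interaction {y + b<..<y + b + a} V =
    (\<integral>\<^sup>+ x. \<integral>\<^sup>+ z. indicator {y + b<..<y + b + a} (x + b) * indicator V z
       * ennreal (1 / (z - (x + b))) \<partial>lborel \<partial>lborel)"
    unfolding interaction_def by (rule nn_integral_lborel_shift) measurable
  also have "\<dots> \<ge> interaction {y<..<y + a} V"
    unfolding interaction_def
  proof (intro nn_integral_mono)
    fix x z
    show "indicator {y<..<y + a} x * indicator V z * ennreal (1 / (z - x))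
      \<le> indicator {y + b<..<y + b + a} (x + b) * indicator V z * ennreal (1 / (z - (x + b)))"
    proof (cases "x \<in> {y<..<y + a} \<and> z \<in> V")
      case True
      then consider "z < y" | "y + a + b < z" using assms(2) by fastforce
      then have "ennreal (1 / (z - x)) \<le> ennreal (1 / (z - (x + b)))"
      proof cases
        case 1
        then show ?thesis using True by (simp add: ennreal_neg)
      next
        case 2
        then show ?thesis using True assms(3) by (intro ennreal_leI divide_left_mono mult_pos_pos) auto
      qed
      then show ?thesis using True by simp
    qed (auto simp: indicator_def)
  qed
  finally show ?thesis .
qed

text \<open>The mirror image: zeros moving to the left approach the ones on the left of the block.\<close>

lemma interaction_shift_left:
  assumes [measurable]: "W \<in> sets borel" and "W \<inter> {y..y + a + b} = {}" and "0 \<le> a"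
  shows "interaction W {y + a<..<y + a + b} \<le> interaction W {y<..<y + b}"
  unfolding interaction_def
proof (rule nn_integral_mono)
  fix w
  have "(\<integral>\<^sup>+ z. indicator W w * indicator {y + a<..<y + a + b} z * ennreal (1 / (z - w)) \<partial>lborel) =
    (\<integral>\<^sup>+ z. indicator W w * indicator {y + a<..<y + a + b} (z + a)
       * ennreal (1 / ((z + a) - w)) \<partial>lborel)"
    by (rule nn_integral_lborel_shift) measurable
  also have "\<dots> \<le> (\<integral>\<^sup>+ z. indicator W w * indicator {y<..<y + b} z * ennreal (1 / (z - w)) \<partial>lborel)"
  proof (intro nn_integral_mono)
    fix z
    show "indicator W w * indicator {y + a<..<y + a + b} (z + a) * ennreal (1 / ((z + a) - w))
      \<le> indicator W w * indicator {y<..<y + b} z * ennreal (1 / (z - w))"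
    proof (cases "w \<in> W \<and> z \<in> {y<..<y + b}")
      case True
      then consider "w < y" | "y + a + b < w" using assms(2) by fastforce
      then have "ennreal (1 / ((z + a) - w)) \<le> ennreal (1 / (z - w))"
      proof cases
        case 1
        then show ?thesis using True assms(3) by (intro ennreal_leI divide_left_mono mult_pos_pos) auto
      next
        case 2
        then show ?thesis using True by (simp add: ennreal_neg)
      qed
      then show ?thesis using True by simp
    qed (auto simp: indicator_def)
  qed
  finally show "(\<integral>\<^sup>+ z. indicator W w * indicator {y + a<..<y + a + b} z * ennreal (1 / (z - w)) \<partial>lborel)
     \<le> (\<integral>\<^sup>+ z. indicator W w * indicator {y<..<y + b} z * ennreal (1 / (z - w)) \<partial>lborel)" .
qed

lemma nn_integral_inverse_sqrt:
  assumes "0 \<le> c"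
  shows "(\<integral>\<^sup>+ s. indicator {0<..<c} s * ennreal (1 / sqrt s) \<partial>lborel) = ennreal (2 * sqrt c)"
proof -
  have "((\<lambda>s. s powr (-1/2)) has_integral (c powr (-1/2 + 1) / (-1/2 + 1))) {0..c}"
    using assms by (intro has_integral_powr_from_0) auto
  then have "((\<lambda>s. s powr (-1/2)) has_integral 2 * sqrt c) {0..c}"
    by (simp add: powr_half_sqrt assms mult.commute)
  then have "(\<integral>\<^sup>+ s. ennreal (indicator {0..c} s * s powr (-1/2)) \<partial>lborel) = ennreal (2 * sqrt c)"
    by (intro nn_integral_has_integral_lebesgue) auto
  moreover have "AE s in lborel. s \<notin> {0, c}"
    by (intro AE_not_in finite_imp_null_set_lborel) auto
  then have "(\<integral>\<^sup>+ s. indicator {0<..<c} s * ennreal (1 / sqrt s) \<partial>lborel)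
     = (\<integral>\<^sup>+ s. ennreal (indicator {0..c} s * s powr (-1/2)) \<partial>lborel)"
  proof (intro nn_integral_cong_AE, elim eventually_mono)
    fix s :: real assume s: "s \<notin> {0, c}"
    show "indicator {0<..<c} s * ennreal (1 / sqrt s) = ennreal (indicator {0..c} s * s powr (-1/2))"
    proof (cases "s \<in> {0<..<c}")
      case True
      then have "s powr (-1/2) = 1 / sqrt s"
        using powr_minus_divide[of s "1/2"] by (simp add: powr_half_sqrt)
      then show ?thesis using True by simp
    next
      case False
      then have "s \<notin> {0..c}" using s by auto
      then show ?thesis using False by simp
    qed
  qed
  ultimately show ?thesis by simp
qed

text \<open>
  The exact value \<open>(a + b) * ln (a + b) - a * ln a - b * ln b\<close> can be avoided: in the distances \<open>s\<close>
  and \<open>t\<close> to the common endpoint the kernel is \<open>1 / (s + t)\<close>, and the arithmetic-geometric mean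
  inequality bounds it by a product, so that the double integral factors.
\<close>

lemma interaction_adjacent_intervals:
  assumes "0 \<le> a" and "0 \<le> b"
  shows "interaction {y<..<y + a} {y + a<..<y + a + b} \<le> ennreal (a + b)"
proof -
  let ?r = "\<lambda>c s. indicator {0<..<c} s * ennreal (1 / sqrt s)"
  have "interaction {y<..<y + a} {y + a<..<y + a + b} =
    (\<integral>\<^sup>+ s. \<integral>\<^sup>+ r. indicator {y<..<y + a} (y + a - s) * indicator {y + a<..<y + a + b} r
       * ennreal (1 / (r - (y + a - s))) \<partial>lborel \<partial>lborel)"
    unfolding interaction_def by (rule nn_integral_lborel_reflect) measurable
  also have "\<dots> =
    (\<integral>\<^sup>+ s. \<integral>\<^sup>+ t. indicator {y<..<y + a} (y + a - s) * indicator {y + a<..<y + a + b} (t + (y + a))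
       * ennreal (1 / (t + (y + a) - (y + a - s))) \<partial>lborel \<partial>lborel)"
    by (intro nn_integral_cong nn_integral_lborel_shift) measurable
  also have "\<dots> \<le> (\<integral>\<^sup>+ s. \<integral>\<^sup>+ t. ennreal (1/2) * (?r a s * ?r b t) \<partial>lborel \<partial>lborel)"
  proof (intro nn_integral_mono)
    fix s t :: real
    show "indicator {y<..<y + a} (y + a - s) * indicator {y + a<..<y + a + b} (t + (y + a))
       * ennreal (1 / (t + (y + a) - (y + a - s))) \<le> ennreal (1/2) * (?r a s * ?r b t)"
    proof (cases "s \<in> {0<..<a} \<and> t \<in> {0<..<b}")
      case True
      then have "2 * (sqrt s * sqrt t) \<le> s + t"
        using arith_geo_mean_sqrt[of s t] by (simp add: real_sqrt_mult)
      then have "1 / (s + t) \<le> 1 / 2 * (1 / sqrt s * (1 / sqrt t))"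
        using True by (simp add: divide_simps mult.assoc)
      then have "ennreal (1 / (t + s)) \<le> ennreal (1 / 2 * (1 / sqrt s * (1 / sqrt t)))"
        by (intro ennreal_leI) (simp only: add.commute)
      also have "\<dots> = ennreal (1 / 2) * ennreal (1 / sqrt s * (1 / sqrt t))"
        using True by (intro ennreal_mult) auto
      also have "ennreal (1 / sqrt s * (1 / sqrt t)) = ennreal (1 / sqrt s) * ennreal (1 / sqrt t)"
        using True by (intro ennreal_mult) auto
      finally show ?thesis using True by (simp add: indicator_def)
    qed (auto simp: indicator_def)
  qed
  also have "\<dots> = ennreal (1/2) * ((\<integral>\<^sup>+ s. ?r a s \<partial>lborel) * (\<integral>\<^sup>+ t. ?r b t \<partial>lborel))"
    by (simp add: nn_integral_cmult nn_integral_multc)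
  also have "\<dots> = ennreal (1/2) * (ennreal (2 * sqrt a) * ennreal (2 * sqrt b))"
    by (simp only: nn_integral_inverse_sqrt[OF assms(1)] nn_integral_inverse_sqrt[OF assms(2)])
  also have "ennreal (2 * sqrt a) * ennreal (2 * sqrt b) = ennreal (2 * sqrt a * (2 * sqrt b))"
    using assms by (intro ennreal_mult[symmetric]) auto
  also have "ennreal (1/2) * \<dots> = ennreal (1/2 * (2 * sqrt a * (2 * sqrt b)))"
    using assms by (intro ennreal_mult[symmetric]) auto
  also have "1/2 * (2 * sqrt a * (2 * sqrt b)) = 2 * sqrt (a * b)"
    by (simp add: real_sqrt_mult)
  also have "\<dots> \<le> ennreal (a + b)"
    using arith_geo_mean_sqrt[OF assms] by (intro ennreal_leI) simp
  finally show ?thesis .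
qed

text \<open>
  Outside the block both configurations have the same ones \<open>W\<close> and zeros \<open>V\<close>.  Splitting the
  potential into the four interactions between block and exterior, three do not decrease and the
  fourth, inside the block, is at most \<open>a + b\<close> before the move.
\<close>

lemma interaction_transposition:
  assumes f: "f \<in> configurations" and T: "transposition_at y a b f g"
  shows "interaction (ones f) (zeros f) \<le> interaction (ones g) (zeros g) + ennreal (a + b)"
proof -
  define I where "I = {y..y + a + b}"
  define W where "W = ones f - I"
  define V where "V = zeros f - I"
  define N where "N = {y, y + a, y + b, y + a + b}"
  let ?P = "{y<..<y + a}" and ?R = "{y + a<..<y + a + b}"
  let ?P' = "{y + b<..<y + b + a}" and ?R' = "{y<..<y + b}"
  have meas: "W \<in> sets borel" "V \<in> sets borel"
    unfolding W_def V_def I_def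
    by (intro sets.Diff ones_borel zeros_borel f atLeastAtMost_borel)+
  have ab: "0 \<le> y" "y < 1" "0 < a" "0 < b" "y + a + b \<le> 1"
    using T by (auto simp: transposition_at_def)
  have fin: "finite N" by (simp add: N_def)
  have f1: "f x = 1" if "x \<in> ?P" for x using T that by (auto simp: transposition_at_def)
  have f0: "f x = 0" if "x \<in> ?R" for x using T that by (auto simp: transposition_at_def)
  have g1: "g x = 1" if "x \<in> ?P'" for x using T that by (auto simp: transposition_at_def)
  have g0: "g x = 0" if "x \<in> ?R'" for x using T that by (auto simp: transposition_at_def)
  have gf: "g x = f x" if "x \<in> {0..1}" "x \<notin> I" for x
    using T that by (auto simp: transposition_at_def I_def)
  have unit: "x \<in> {0..1}" if "x \<in> I" for x using that ab by (auto simp: I_def)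
  have split: "x \<in> ?P \<or> x \<in> ?R" "x \<in> ?P' \<or> x \<in> ?R'" if "x \<in> I" "x \<notin> N" for x
    using that by (auto simp: I_def N_def)
  have sub: "?P \<subseteq> I" "?R \<subseteq> I" "?P' \<subseteq> I" "?R' \<subseteq> I"
    using ab by (auto simp: I_def)
  have of: "x \<in> ones f \<longleftrightarrow> x \<in> ?P \<union> W" if "x \<notin> N" for x
    using split(1)[OF _ that] unit[of x] f1[of x] f0[of x] sub by (auto simp: W_def ones_def)
  have zf: "x \<in> zeros f \<longleftrightarrow> x \<in> ?R \<union> V" if "x \<notin> N" for x
    using split(1)[OF _ that] unit[of x] f1[of x] f0[of x] sub by (auto simp: V_def zeros_def)
  have og: "x \<in> ones g \<longleftrightarrow> x \<in> ?P' \<union> W" if "x \<notin> N" for x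
    using split(2)[OF _ that] unit[of x] g1[of x] g0[of x] gf[of x] sub
    by (cases "x \<in> I") (auto simp: W_def ones_def)
  have zg: "x \<in> zeros g \<longleftrightarrow> x \<in> ?R' \<union> V" if "x \<notin> N" for x
    using split(2)[OF _ that] unit[of x] g1[of x] g0[of x] gf[of x] sub
    by (cases "x \<in> I") (auto simp: V_def zeros_def)
  have disj: "?P \<inter> W = {}" "?R \<inter> V = {}" "?P' \<inter> W = {}" "?R' \<inter> V = {}"
    using sub by (auto simp: W_def V_def)
  have outside: "W \<inter> {y..y + a + b} = {}" "V \<inter> {y..y + a + b} = {}"
    by (auto simp: W_def V_def I_def)
  have "interaction (ones f) (zeros f) = interaction (?P \<union> W) (?R \<union> V)"
    using fin of zf by (rule interaction_cong_null)
  also have "\<dots> = interaction ?P ?R + interaction ?P V + (interaction W ?R + interaction W V)"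
    using disj meas by (simp add: interaction_Un_left interaction_Un_right)
  also have "\<dots> \<le> ennreal (a + b) + interaction ?P' V + (interaction W ?R' + interaction W V)"
    using ab meas outside
    by (intro add_mono interaction_adjacent_intervals interaction_shift_right interaction_shift_left) auto
  also have "\<dots> \<le> ennreal (a + b)
     + (interaction ?P' ?R' + interaction ?P' V + (interaction W ?R' + interaction W V))"
    unfolding add.assoc by (intro add_left_mono add_increasing[OF zero_le order_refl])
  also have "\<dots> = ennreal (a + b) + interaction (?P' \<union> W) (?R' \<union> V)"
    using disj meas by (simp add: interaction_Un_left interaction_Un_right)
  also have "interaction (?P' \<union> W) (?R' \<union> V) = interaction (ones g) (zeros g)"
    using fin og zg by (rule interaction_cong_null[symmetric])
  finally show ?thesis by (simp add: add.commute)
qed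

lemma interaction_le_cost:
  assumes "rearrangement f n F"
  shows "interaction (ones f) (zeros f) \<le> ennreal (rearrangement_cost n F)"
proof -
  have conf: "F j \<in> configurations" if "j \<le> n" for j
    using assms that by (simp add: rearrangement_def)
  have "interaction (ones f) (zeros f)
      \<le> interaction (ones (F j)) (zeros (F j)) + ennreal (rearrangement_cost j F)
      \<and> 0 \<le> rearrangement_cost j F"
    if "j \<le> n" for j
    using that
  proof (induction j)
    case 0
    then show ?case using assms by (simp add: rearrangement_def rearrangement_cost_def)
  next
    case (Suc j)
    have "elementary_transposition (F j) (F (Suc j))"
      using assms Suc.prems by (auto simp: rearrangement_def dest!: bspec[of _ _ "Suc j"])
    then obtain y a b where T: "transposition_at y a b (F j) (F (Suc j))"
      by (auto simp: elementary_transposition_def)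
    have ab: "0 < a" "0 < b" using T by (auto simp: transposition_at_def)
    have cost: "rearrangement_cost (Suc j) F = rearrangement_cost j F + (a + b)"
      by (simp add: rearrangement_cost_def transposition_cost_eq[OF T])
    have IH: "interaction (ones f) (zeros f)
        \<le> interaction (ones (F j)) (zeros (F j)) + ennreal (rearrangement_cost j F)"
      "0 \<le> rearrangement_cost j F"
      using Suc by auto
    note IH(1)
    also have "interaction (ones (F j)) (zeros (F j)) + ennreal (rearrangement_cost j F)
       \<le> interaction (ones (F (Suc j))) (zeros (F (Suc j))) + ennreal (a + b)
          + ennreal (rearrangement_cost j F)"
      using Suc.prems by (intro add_right_mono interaction_transposition[OF _ T] conf) auto
    also have "\<dots> = interaction (ones (F (Suc j))) (zeros (F (Suc j)))
          + ennreal (rearrangement_cost (Suc j) F)"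
      using ab IH(2) by (simp add: cost add_ac flip: ennreal_plus)
    finally show ?case using ab IH(2) cost by simp
  qed
  from this[of n] show ?thesis
    using assms by (simp add: rearrangement_def interaction_monotone)
qed

section \<open>Well-stirred configurations have a large potential\<close>

lemma sum_emeasure_le_nn_integral:
  fixes r :: "nat \<Rightarrow> ennreal"
  assumes [measurable]: "h \<in> borel_measurable M" "\<And>d. d < m \<Longrightarrow> A d \<in> sets M"
    and disj: "disjoint_family_on A {..<m}"
    and le: "\<And>d z. d < m \<Longrightarrow> z \<in> A d \<Longrightarrow> r d \<le> h z"
  shows "(\<Sum>d<m. r d * emeasure M (A d)) \<le> (\<integral>\<^sup>+ z. h z \<partial>M)"
proof -
  have "(\<Sum>d<m. r d * emeasure M (A d)) = (\<integral>\<^sup>+ z. (\<Sum>d<m. r d * indicator (A d) z) \<partial>M)"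
    by (subst nn_integral_sum) (auto simp: nn_integral_cmult_indicator)
  also have "\<dots> \<le> (\<integral>\<^sup>+ z. h z \<partial>M)"
  proof (rule nn_integral_mono)
    fix z
    show "(\<Sum>d<m. r d * indicator (A d) z) \<le> h z"
    proof (cases "\<exists>d<m. z \<in> A d")
      case True
      then obtain d where d: "d < m" "z \<in> A d" by blast
      have "(\<Sum>e<m. r e * indicator (A e) z) = (\<Sum>e\<in>{d}. r e * indicator (A e) z)"
        using d disj by (intro sum.mono_neutral_right) (auto simp: disjoint_family_on_def indicator_def)
      then show ?thesis using le[OF d] d by simp
    qed (auto simp: indicator_def)
  qed
  finally show ?thesis .
qed

lemma disjoint_family_windows:
  fixes x \<epsilon> :: real
  assumes "0 < \<epsilon>"
  shows "disjoint_family_on (\<lambda>d::nat. Y \<inter> {x + real d * \<epsilon><..x + real (Suc d) * \<epsilon>}) D"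
proof -
  have "d = e" if "x + real d * \<epsilon> < z" "z \<le> x + real (Suc d) * \<epsilon>"
    "x + real e * \<epsilon> < z" "z \<le> x + real (Suc e) * \<epsilon>" for d e :: nat and z
  proof -
    have "real d * \<epsilon> < real (Suc e) * \<epsilon>" "real e * \<epsilon> < real (Suc d) * \<epsilon>"
      using that by linarith+
    then have "d < Suc e" "e < Suc d" using assms by (simp_all only: mult_less_cancel_right_pos of_nat_less_iff)
    then show ?thesis by simp
  qed
  then show ?thesis by (fastforce simp: disjoint_family_on_def)
qed

text \<open>
  The two bounds in the definition of being well stirred give the two claims, since ones and zeros
  together fill the window.
\<close>

lemma well_stirred_window:
  assumes "f \<in> configurations" and "well_stirred \<kappa> \<epsilon> f" and "0 < \<epsilon>" and y: "0 \<le> y" "y + \<epsilon> \<le> 1"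
  shows "ennreal (\<kappa> * \<epsilon>) \<le> emeasure lborel (ones f \<inter> {y<..y + \<epsilon>})"
    and "ennreal (\<kappa> * \<epsilon>) \<le> emeasure lborel (zeros f \<inter> {y<..y + \<epsilon>})"
proof -
  note [measurable] = ones_borel[OF assms(1)] zeros_borel[OF assms(1)]
  let ?J = "{y<..y + \<epsilon>}"
  let ?m1 = "measure lborel (ones f \<inter> ?J)" and ?m0 = "measure lborel (zeros f \<inter> ?J)"
  have fin: "emeasure lborel (Y \<inter> ?J) < \<infinity>" if "Y \<in> sets borel" for Y
  proof -
    have "emeasure lborel (Y \<inter> ?J) \<le> emeasure lborel ?J" by (intro emeasure_mono) auto
    also have "\<dots> < \<infinity>" using \<open>0 < \<epsilon>\<close> by (simp add: emeasure_lborel_Ioc)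
    finally show ?thesis .
  qed
  have val: "f x = 0 \<or> f x = 1" if "x \<in> ?J" for x
    using assms(1) y that by (auto simp: configurations_def PiE_iff Ball_def)
  have "emeasure lborel (ones f \<inter> ?J) = ennreal ?m1"
    using fin[of "ones f"] by (simp add: emeasure_eq_ennreal_measure)
  then have "((\<lambda>x. 1) has_integral ?m1) (ones f \<inter> ?J)"
    by (subst has_integral_iff_emeasure_lborel) auto
  then have "((\<lambda>x. if x \<in> ones f \<inter> ?J then 1 else 0) has_integral ?m1) {y..y + \<epsilon>}"
    by (subst has_integral_restrict) auto
  then have "(f has_integral ?m1) {y..y + \<epsilon>}"
  proof (rule has_integral_spike_finite[rotated 2, of _ _ _ "{y}"])
    fix x assume "x \<in> {y..y + \<epsilon>} - {y}"
    then show "f x = (if x \<in> ones f \<inter> ?J then 1 else 0)"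
      using val[of x] y by (auto simp: ones_def)
  qed simp
  then have I: "integral {y..y + \<epsilon>} f = ?m1" by (rule integral_unique)
  have "?J = (ones f \<inter> ?J) \<union> (zeros f \<inter> ?J)"
  proof (intro set_eqI iffI)
    fix x assume "x \<in> ?J"
    then show "x \<in> (ones f \<inter> ?J) \<union> (zeros f \<inter> ?J)"
      using val[of x] y by (auto simp: ones_def zeros_def)
  qed auto
  moreover have "(ones f \<inter> ?J) \<inter> (zeros f \<inter> ?J) = {}"
    by (auto simp: ones_def zeros_def)
  ultimately have "measure lborel ?J = ?m1 + ?m0"
    using measure_Union[of lborel "ones f \<inter> ?J" "zeros f \<inter> ?J"] fin[of "ones f"] fin[of "zeros f"]
    by simp
  then have sum: "?m1 + ?m0 = \<epsilon>" using assms(3) by simp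
  have "\<kappa> * \<epsilon> < ?m1" "?m1 \<le> (1 - \<kappa>) * \<epsilon>"
    using assms(2) y unfolding well_stirred_def I[symmetric] by auto
  then have "\<kappa> * \<epsilon> \<le> ?m1" "\<kappa> * \<epsilon> \<le> ?m0" using sum by (auto simp: algebra_simps)
  then show "ennreal (\<kappa> * \<epsilon>) \<le> emeasure lborel (ones f \<inter> ?J)"
    and "ennreal (\<kappa> * \<epsilon>) \<le> emeasure lborel (zeros f \<inter> ?J)"
    using fin[of "ones f"] fin[of "zeros f"] by (simp_all add: emeasure_eq_ennreal_measure ennreal_leI)
qed

text \<open>
  Let \<open>M\<close> be the number of windows of length \<open>\<epsilon>\<close> that fit into half of the unit interval.  Since
  \<open>1 \<le> M\<close>, both \<open>M * \<epsilon>\<close> is at least \<open>1/4\<close> and \<open>ln (M + 1)\<close> at least \<open>ln (1 / \<epsilon>) / 2\<close>, which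
  makes the bound a multiple of \<open>ln (1 / \<epsilon>)\<close> on the whole range \<open>\<epsilon> \<le> 1/2\<close>, with no additive error.
\<close>

lemma well_stirred_interaction:
  assumes f: "f \<in> configurations" and stirred: "well_stirred \<kappa> \<epsilon> f"
    and \<kappa>: "0 < \<kappa>" and \<epsilon>: "0 < \<epsilon>" "\<epsilon> \<le> 1 / 2"
  shows "ennreal (\<kappa>\<^sup>2 / 8 * ln (1 / \<epsilon>)) \<le> interaction (ones f) (zeros f)"
proof -
  note [measurable] = ones_borel[OF f] zeros_borel[OF f]
  define M where "M = nat \<lfloor>1 / (2 * \<epsilon>)\<rfloor>"
  have floor: "real M \<le> 1 / (2 * \<epsilon>)" "1 / (2 * \<epsilon>) < real M + 1"
    using \<epsilon> unfolding M_def by (simp, linarith)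
  have M1: "1 \<le> M"
    using \<epsilon> unfolding M_def by (simp add: le_nat_iff le_floor_iff)
  have Mhalf: "real M * \<epsilon> \<le> 1 / 2"
    using floor(1) \<epsilon> by (simp add: field_simps)
  have "1 / 2 < real M * \<epsilon> + \<epsilon>"
    using floor(2) \<epsilon> by (simp add: field_simps)
  moreover have "\<epsilon> \<le> real M * \<epsilon>"
    using M1 \<epsilon> by simp
  ultimately have Mquarter: "1 / 4 \<le> real M * \<epsilon>" by linarith
  have "1 / \<epsilon> \<le> 2 * (real M + 1)"
    using floor(2) \<epsilon> by (simp add: field_simps)
  also have "\<dots> \<le> (real M + 1)\<^sup>2"
    unfolding power2_eq_square using M1 by (intro mult_right_mono) auto
  finally have "ln (1 / \<epsilon>) \<le> ln ((real M + 1)\<^sup>2)"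
    using \<epsilon> by (subst ln_le_cancel_iff) auto
  then have "ln (1 / \<epsilon>) / 2 \<le> ln (real M + 1)"
    by (simp add: ln_realpow)
  also have "\<dots> \<le> harm M" by (rule ln_le_harm)
  finally have log: "ln (1 / \<epsilon>) / 2 \<le> harm M" .
  define win where "win x d = {x + real d * \<epsilon><..x + real (Suc d) * \<epsilon>}" for x :: real and d :: nat
  have win: "win x d = {x + real d * \<epsilon><..x + real d * \<epsilon> + \<epsilon>}" for x d
    by (simp add: win_def algebra_simps)
  have win_le: "x + real d * \<epsilon> + \<epsilon> \<le> x + real M * \<epsilon>" if "d < M" for x d
  proof -
    have "real (Suc d) * \<epsilon> \<le> real M * \<epsilon>" using that \<epsilon> by (intro mult_right_mono) auto
    then show ?thesis by (simp add: algebra_simps)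
  qed
  \<comment> \<open>The zeros seen from a single point of the left half contribute a harmonic sum.\<close>
  have inner: "ennreal (\<kappa> / 2 * ln (1 / \<epsilon>))
      \<le> (\<integral>\<^sup>+ y. indicator (zeros f) y * ennreal (1 / (y - x)) \<partial>lborel)"
    if x: "0 \<le> x" "x \<le> 1 / 2" for x
  proof -
    have "\<kappa> / 2 * ln (1 / \<epsilon>) \<le> \<kappa> * harm M"
      using log \<kappa> mult_left_mono[OF log, of \<kappa>] by simp
    also have "\<dots> = (\<Sum>d<M. 1 / (real (Suc d) * \<epsilon>) * (\<kappa> * \<epsilon>))"
      unfolding harm_def sum_distrib_left One_nat_def sum.atLeast1_atMost_eq
    using \<epsilon> by (intro sum.cong refl) (simp add: field_simps del: of_nat_Suc)
    finally have "ennreal (\<kappa> / 2 * ln (1 / \<epsilon>)) \<le> ennreal (\<Sum>d<M. 1 / (real (Suc d) * \<epsilon>) * (\<kappa> * \<epsilon>))"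
      by (rule ennreal_leI)
    also have "\<dots> = (\<Sum>d<M. ennreal (1 / (real (Suc d) * \<epsilon>)) * ennreal (\<kappa> * \<epsilon>))"
      using \<kappa> \<epsilon> by (simp add: ennreal_mult[symmetric] sum_ennreal del: of_nat_Suc)
    also have "\<dots> \<le> (\<Sum>d<M. ennreal (1 / (real (Suc d) * \<epsilon>)) * emeasure lborel (zeros f \<inter> win x d))"
      unfolding win using win_le[of _ x] Mhalf x \<epsilon>
      by (intro sum_mono mult_left_mono well_stirred_window(2)[OF f stirred \<epsilon>(1)]) (fastforce)+
    also have "\<dots> \<le> (\<integral>\<^sup>+ y. indicator (zeros f) y * ennreal (1 / (y - x)) \<partial>lborel)"
    proof (rule sum_emeasure_le_nn_integral)
      show "disjoint_family_on (\<lambda>d. zeros f \<inter> win x d) {..<M}"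
        unfolding win_def by (rule disjoint_family_windows) (rule \<epsilon>)
      fix d y assume "y \<in> zeros f \<inter> win x d"
      then have y: "y \<in> zeros f" "x + real d * \<epsilon> < y" "y - x \<le> real (Suc d) * \<epsilon>"
        by (auto simp: win_def)
      moreover have "0 \<le> real d * \<epsilon>" using \<epsilon> by simp
      ultimately have "0 < y - x" by linarith
      then have "1 / (real (Suc d) * \<epsilon>) \<le> 1 / (y - x)"
        using y \<epsilon> by (intro divide_left_mono) auto
      then show "ennreal (1 / (real (Suc d) * \<epsilon>)) \<le> indicator (zeros f) y * ennreal (1 / (y - x))"
        using y(1) by (simp add: ennreal_leI del: of_nat_Suc)
    qed (auto simp: win_def)
    finally show ?thesis .
  qed
  have "\<kappa>\<^sup>2 / 8 * ln (1 / \<epsilon>) = \<kappa> / 2 * ln (1 / \<epsilon>) * \<kappa> * (1 / 4)"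
    by (simp add: power2_eq_square)
  also have "\<dots> \<le> \<kappa> / 2 * ln (1 / \<epsilon>) * \<kappa> * (real M * \<epsilon>)"
    using Mquarter \<kappa> \<epsilon> by (intro mult_left_mono) auto
  also have "\<dots> = (\<Sum>d<M. \<kappa> / 2 * ln (1 / \<epsilon>) * (\<kappa> * \<epsilon>))" by simp
  finally have "ennreal (\<kappa>\<^sup>2 / 8 * ln (1 / \<epsilon>)) \<le> ennreal (\<Sum>d<M. \<kappa> / 2 * ln (1 / \<epsilon>) * (\<kappa> * \<epsilon>))"
    by (rule ennreal_leI)
  also have "\<dots> = (\<Sum>d<M. ennreal (\<kappa> / 2 * ln (1 / \<epsilon>)) * ennreal (\<kappa> * \<epsilon>))"
  proof -
    have "ennreal (\<kappa> / 2 * ln (1 / \<epsilon>) * (\<kappa> * \<epsilon>))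
        = ennreal (\<kappa> / 2 * ln (1 / \<epsilon>)) * ennreal (\<kappa> * \<epsilon>)"
      using \<kappa> \<epsilon> by (intro ennreal_mult) auto
    then show ?thesis
      using \<kappa> \<epsilon> by (subst sum_ennreal[symmetric]) (auto simp del: sum_constant)
  qed
  also have "\<dots> \<le> (\<Sum>d<M. ennreal (\<kappa> / 2 * ln (1 / \<epsilon>)) * emeasure lborel (ones f \<inter> win 0 d))"
    unfolding win using win_le[of _ 0] Mhalf \<epsilon>
    by (intro sum_mono mult_left_mono well_stirred_window(1)[OF f stirred \<epsilon>(1)]) (fastforce)+
  also have "\<dots> \<le> interaction (ones f) (zeros f)"
    unfolding interaction_def
  proof (rule sum_emeasure_le_nn_integral)
    show "disjoint_family_on (\<lambda>d. ones f \<inter> win 0 d) {..<M}"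
      unfolding win_def by (rule disjoint_family_windows) (rule \<epsilon>)
    fix d x assume d: "d < M" and x: "x \<in> ones f \<inter> win 0 d"
    then have "0 \<le> x" "x \<le> 1 / 2"
      using win_le[OF d, of 0] Mhalf by (auto simp: win ones_def)
    then show "ennreal (\<kappa> / 2 * ln (1 / \<epsilon>))
      \<le> (\<integral>\<^sup>+ y. indicator (ones f) x * indicator (zeros f) y * ennreal (1 / (y - x)) \<partial>lborel)"
      using inner[of x] x by simp
  qed (auto simp: win_def)
  finally show ?thesis .
qed

theorem mainTheorem1:
  fixes \<kappa> :: real
  assumes "0 < \<kappa>" and "\<kappa> < 1"
  shows "\<exists>C>0. \<forall>(\<epsilon>::real) f n F.
           0 < \<epsilon> \<longrightarrow> \<epsilon> \<le> 1/2 \<longrightarrow> f \<in> configurations \<longrightarrow> well_stirred \<kappa> \<epsilon> f \<longrightarrow>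
           rearrangement f n F \<longrightarrow>
           rearrangement_cost n F \<ge> C * \<bar>ln \<epsilon>\<bar>"
proof (intro exI[of _ "\<kappa>\<^sup>2 / 8"] conjI allI impI)
  show "0 < \<kappa>\<^sup>2 / 8" using assms by simp
  fix \<epsilon> :: real and f n F
  assume \<epsilon>: "0 < \<epsilon>" "\<epsilon> \<le> 1/2" and f: "f \<in> configurations" "well_stirred \<kappa> \<epsilon> f"
    and R: "rearrangement f n F"
  have ln: "\<bar>ln \<epsilon>\<bar> = ln (1 / \<epsilon>)" "0 < ln (1 / \<epsilon>)"
    using \<epsilon> by (simp_all add: ln_div)
  have "ennreal (\<kappa>\<^sup>2 / 8 * ln (1 / \<epsilon>)) \<le> ennreal (rearrangement_cost n F)"
    using well_stirred_interaction[OF f assms(1) \<epsilon>] interaction_le_cost[OF R] by (rule order_trans)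
  moreover have "0 < \<kappa>\<^sup>2 / 8 * ln (1 / \<epsilon>)" using assms ln(2) by simp
  ultimately show "\<kappa>\<^sup>2 / 8 * \<bar>ln \<epsilon>\<bar> \<le> rearrangement_cost n F"
    unfolding ln(1) by (metis ennreal_le_iff2 not_le)
qed

end
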